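(* Let $p\in\mathbb{R}$, $p\ne\pm1$, $P=(p,0)$, $P'=(-p,0)$, $\theta\in(0,\pi)$, $\phi\in\mathbb{R}$. For integers $j$ let $X_j=(\cos(j\theta+\phi),\sin(j\theta+\phi))$ and let $L_j$ be the line through $X_j$ orthogonal to $PX_j$. Let $C_L$ be the limiting conic (the envelope of all lines through a point $X$ of the unit circle orthogonal to $PX$), let $M_j=C_L\cap L_j$ be the tangency points, and let $V_j=L_j\cap L_{j+1}$. Then the points $V_j$ lie on a conic which is independent of $\phi$ and has focus $P'$, and they form a discrete conic of angle $\theta$ (with respect to the focus $P'$). Moreover, writing $D=V_1V_2\cdots$ and $M=M_1M_2\cdots$, one has $D=G_\theta(M)$.
   Context: Work in the real projective plane containing $\mathbb{R}^2$. A sequence of points $V_1,V_2,\dots$ on a nondegenerate conic $C$ with focus $F$ forms a discrete conic of angle $\theta$ (with respect to $F$; here the polygon need not be closed) if $\angle V_iFV_{i+1}=\theta$ (directed angle) for all consecutive vertices. When $C$ is a hyperbola or parabola, the rays from $F$ used in measuring angles may wrap around through infinity: in polar coordinates $(r,\varphi)$ centered at $F$ in which $C$ has equation $r(1+e\cos\varphi)=\ell$ with $\ell>0$, $e\ge0$, $r$ allowed negative or infinite, each point $V\in C$ has a unique angle $\varphi(V)$ mod $2\pi$, and $\angle VFW=\theta$ means $\varphi(W)-\varphi(V)\equiv\theta$ mod $2\pi$. The limiting conic $C_L$ is a conic with foci $P$ and $P'$. For a discrete conic $M=M_1M_2\cdots$ of angle $\theta$ lying on a conic $C_L$, $G_\theta(M)$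 denotes the polygon whose vertices are the intersections of the tangents to $C_L$ at consecutive vertices $M_j$, $M_{j+1}$; the equality $D=G_\theta(M)$ includes the assertion that $M$ is a discrete conic of angle $\theta$ on $C_L$ with respect to the focus $P'$. *)

theory Defs
  imports "HOL-Analysis.Analysis" "HOL-Library.Real_Mod"
begin

text \<open>
  The real projective plane: points are the lines through the origin of 3-space. The plane
  sits inside it by \<open>(x, y) \<mapsto> [x : y : 1]\<close>; the points \<open>[x : y : 0]\<close> are at infinity.
\<close>

typedef rp2 = "{S :: (real^3) set. subspace S \<and> dim S = 1}"
proof -
  have "dim (span {axis 1 1 :: real^3}) = 1"
    by (simp add: dim_eq_card_independent axis_eq_0_iff)
  thus ?thesis by (blast intro: subspace_span)
qed

text \<open>Only meaningful for \<open>(x, y, w) \<noteq> (0, 0, 0)\<close>.\<close>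

definition hpoint :: "real \<Rightarrow> real \<Rightarrow> real \<Rightarrow> rp2" where
  "hpoint x y w = Abs_rp2 (span {vector [x, y, w]})"

definition pline :: "real^3 \<Rightarrow> rp2 set" where
  "pline a = {Q. \<forall>v \<in> Rep_rp2 Q. a \<bullet> v = 0}"

definition quadric :: "real^3^3 \<Rightarrow> rp2 set" where
  "quadric A = {Q. \<forall>v \<in> Rep_rp2 Q. v \<bullet> (A *v v) = 0}"

text \<open>Nonemptiness excludes the definite forms, whose conics have no real points.\<close>

definition nondegenerate_conic :: "rp2 set \<Rightarrow> bool" where
  "nondegenerate_conic C \<longleftrightarrow>
     C \<noteq> {} \<and> (\<exists>A. transpose A = A \<and> det A \<noteq> 0 \<and> C = quadric A)"

text \<open>The tangent at \<open>Q\<close> is the polar line of \<open>Q\<close>.\<close>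

definition tangent_line :: "rp2 set \<Rightarrow> rp2 \<Rightarrow> rp2 set \<Rightarrow> bool" where
  "tangent_line C Q l \<longleftrightarrow> Q \<in> C \<and>
     (\<exists>A. transpose A = A \<and> det A \<noteq> 0 \<and> C = quadric A \<and>
          l = {R. \<forall>v \<in> Rep_rp2 Q. \<forall>w \<in> Rep_rp2 R. w \<bullet> (A *v v) = 0})"

text \<open>
  The point of angle \<open>\<psi>\<close> on \<open>r (1 + e cos \<psi>) = l\<close>, in polar coordinates centred at \<open>F\<close> whose
  axis has direction \<open>\<alpha>\<close>: this is \<open>F + r (cos (\<alpha> + \<psi>), sin (\<alpha> + \<psi>))\<close> with
  \<open>r = l / (1 + e cos \<psi>)\<close>, where homogeneous coordinates have been multiplied by
  \<open>1 + e cos \<psi>\<close>. So \<open>r\<close> may be negative, and \<open>r = \<infinity>\<close> is the point at infinity in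
  direction \<open>\<alpha> + \<psi>\<close>.
\<close>

definition polar_point :: "real^2 \<Rightarrow> real \<Rightarrow> real \<Rightarrow> real \<Rightarrow> real \<Rightarrow> rp2" where
  "polar_point F \<alpha> e l \<psi> =
     hpoint ((1 + e * cos \<psi>) * F $ 1 + l * cos (\<alpha> + \<psi>))
            ((1 + e * cos \<psi>) * F $ 2 + l * sin (\<alpha> + \<psi>))
            (1 + e * cos \<psi>)"

definition polar_equation :: "rp2 set \<Rightarrow> real^2 \<Rightarrow> real \<Rightarrow> real \<Rightarrow> real \<Rightarrow> bool" where
  "polar_equation C F \<alpha> e l \<longleftrightarrow> e \<ge> 0 \<and> l > 0 \<and> C = range (polar_point F \<alpha> e l)"

definition conic_with_focus :: "rp2 set \<Rightarrow> real^2 \<Rightarrow> bool" where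
  "conic_with_focus C F \<longleftrightarrow> nondegenerate_conic C \<and> (\<exists>\<alpha> e l. polar_equation C F \<alpha> e l)"

definition focal_angle :: "rp2 set \<Rightarrow> real^2 \<Rightarrow> rp2 \<Rightarrow> rp2 \<Rightarrow> real \<Rightarrow> bool" where
  "focal_angle C F V W \<theta> \<longleftrightarrow>
     (\<exists>\<alpha> e l \<psi> \<psi>'. polar_equation C F \<alpha> e l \<and>
        V = polar_point F \<alpha> e l \<psi> \<and> W = polar_point F \<alpha> e l \<psi>' \<and>
        [\<psi>' - \<psi> = \<theta>] (rmod (2 * pi)))"

definition discrete_conic :: "rp2 set \<Rightarrow> real^2 \<Rightarrow> real \<Rightarrow> (nat \<Rightarrow> rp2) \<Rightarrow> bool" where
  "discrete_conic C F \<theta> V \<longleftrightarrow> conic_with_focus C F \<and> (\<forall>n. V n \<in> C) \<and>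
     (\<forall>n. focal_angle C F (V n) (V (Suc n)) \<theta>)"

text \<open>
  \<open>is_G C F \<theta> M D\<close> reads \<open>D = G\<^sub>\<theta>(M)\<close>, including that \<open>M\<close> is a discrete conic of
  angle \<open>\<theta>\<close> on \<open>C\<close> with respect to \<open>F\<close>.
\<close>

definition is_G :: "rp2 set \<Rightarrow> real^2 \<Rightarrow> real \<Rightarrow> (nat \<Rightarrow> rp2) \<Rightarrow> (nat \<Rightarrow> rp2) \<Rightarrow> bool" where
  "is_G C F \<theta> M D \<longleftrightarrow> discrete_conic C F \<theta> M \<and>
     (\<forall>n. \<exists>l l'. tangent_line C (M n) l \<and> tangent_line C (M (Suc n)) l' \<and> l \<inter> l' = {D n})"

text \<open>
  Coordinates of the line through \<open>X\<close> orthogonal to \<open>PX\<close>: its affine points \<open>Y\<close> are those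
  with \<open>(X - P) \<bullet> (Y - X) = 0\<close>.
\<close>

definition perp_coords :: "real^2 \<Rightarrow> real^2 \<Rightarrow> real^3" where
  "perp_coords P X = vector [(X - P) $ 1, (X - P) $ 2, - ((X - P) \<bullet> X)]"

definition perp_line :: "real^2 \<Rightarrow> real^2 \<Rightarrow> rp2 set" where
  "perp_line P X = pline (perp_coords P X)"

definition circle_point :: "real \<Rightarrow> real^2" where
  "circle_point t = vector [cos t, sin t]"

text \<open>
  The envelope of the lines \<open>a t \<bullet> v = 0\<close> is obtained by eliminating \<open>t\<close> from this equation
  and its derivative with respect to \<open>t\<close>.
\<close>

definition envelope :: "(real \<Rightarrow> real^3) \<Rightarrow> rp2 set" where
  "envelope a = {Q. \<exists>t a'. (a has_vector_derivative a') (at t) \<and> Q \<in> pline (a t) \<and> Q \<in> pline a'}"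

definition limiting_conic :: "real^2 \<Rightarrow> rp2 set" where
  "limiting_conic P = envelope (\<lambda>t. perp_coords P (circle_point t))"

end

theory Submission
  imports Defs
begin

text \<open>
  With \<open>a t\<close> the coordinates of the line through \<open>(cos t, sin t)\<close>, the tangency point
  \<open>a t \<times> a' t\<close> is \<open>P' + (1 - p\<^sup>2) / (1 - p cos t) (cos t, sin t)\<close>, and the lines of parameters
  \<open>m - h\<close> and \<open>m + h\<close> meet at \<open>P' + (1 - p\<^sup>2) / (cos h - p cos m) (cos m, sin m)\<close>.
  Both are polar equations with focus \<open>P'\<close>, with the circle parameter as polar angle, so an
  increment of \<open>\<theta>\<close> on the circle is an increment of \<open>\<theta>\<close> around \<open>P'\<close>.
  For fixed \<open>h = \<theta>/2\<close> the second conic does not depend on \<open>\<phi>\<close>. The eccentricity and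
  parameter appear here with arbitrary signs; half-turns of the axis and of the angle make them
  nonnegative.
\<close>

section \<open>Homogeneous coordinates\<close>

lemma vector_3_eq_0_iff:
  "(vector [x, y, w] :: real^3) = 0 \<longleftrightarrow> x = 0 \<and> y = 0 \<and> w = 0"
  by (simp add: vec_eq_iff forall_3)

lemma Rep_hpoint:
  assumes "(vector [x, y, w] :: real^3) \<noteq> 0"
  shows "Rep_rp2 (hpoint x y w) = span {vector [x, y, w]}"
proof -
  have "dim (span {vector [x, y, w] :: real^3}) = 1"
    using assms by (simp add: dim_eq_card_independent)
  thus ?thesis
    by (simp add: hpoint_def Abs_rp2_inverse)
qed

text \<open>The single vector of a basis of the one-dimensional subspace supplies homogeneous
  coordinates. This makes an arbitrary point accessible to the coordinate criteria that
  follow.\<close>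

lemma rp2_cases:
  obtains x y w where "(vector [x, y, w] :: real^3) \<noteq> 0" "Q = hpoint x y w"
proof -
  have S: "subspace (Rep_rp2 Q)" "dim (Rep_rp2 Q) = 1"
    using Rep_rp2[of Q] by auto
  obtain B where B: "B \<subseteq> Rep_rp2 Q" "independent B" "Rep_rp2 Q \<subseteq> span B" "card B = 1"
    using basis_exists[of "Rep_rp2 Q"] S(2) by metis
  then obtain v where v: "B = {v}"
    by (auto simp: card_1_singleton_iff)
  have "Rep_rp2 Q = span {v}"
    using B v S(1) span_minimal[of "{v}" "Rep_rp2 Q"] by auto
  hence Q: "Q = Abs_rp2 (span {v})"
    by (metis Rep_rp2_inverse)
  have e: "vector [v $ 1, v $ 2, v $ 3] = v"
    by (simp add: vec_eq_iff forall_3)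
  have "v \<noteq> 0"
    using B(2) v by simp
  with e Q show ?thesis
    using that[of "v $ 1" "v $ 2" "v $ 3"] by (simp add: hpoint_def)
qed

lemma hpoint_scale:
  assumes "c \<noteq> 0"
  shows "hpoint (c * x) (c * y) (c * w) = hpoint x y w"
proof -
  have "(vector [c * x, c * y, c * w] :: real^3) = c *\<^sub>R vector [x, y, w]"
    by (simp add: vec_eq_iff forall_3)
  moreover have "span {c *\<^sub>R v} = span {v}" for v :: "real^3"
    using span_image_scale[of "{v}" "\<lambda>_. c"] assms by simp
  ultimately show ?thesis
    by (simp add: hpoint_def)
qed

lemma hpoint_in_pline_iff:
  assumes "(vector [x, y, w] :: real^3) \<noteq> 0"
  shows "hpoint x y w \<in> pline a \<longleftrightarrow> a \<bullet> vector [x, y, w] = 0"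
  using assms by (auto simp: pline_def Rep_hpoint span_singleton)

lemma hpoint_in_quadric_iff:
  assumes "(vector [x, y, w] :: real^3) \<noteq> 0"
  shows "hpoint x y w \<in> quadric A \<longleftrightarrow> vector [x, y, w] \<bullet> (A *v vector [x, y, w]) = 0"
  using assms
  by (auto simp: quadric_def Rep_hpoint span_singleton matrix_vector_mult_scaleR)

text \<open>Rescaling a representative only rescales \<open>A *v v\<close>, so one representative
  decides. This turns the polar in \<open>tangent_line\<close> into a \<open>pline\<close> with
  explicit coordinates.\<close>

lemma polar_of_hpoint:
  assumes "(vector [x, y, w] :: real^3) \<noteq> 0"
  shows "{R. \<forall>v \<in> Rep_rp2 (hpoint x y w). \<forall>u \<in> Rep_rp2 R. u \<bullet> (A *v v) = 0}
    = pline (A *v vector [x, y, w])"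
proof (intro set_eqI iffI)
  fix R assume "R \<in> pline (A *v vector [x, y, w])"
  thus "R \<in> {R. \<forall>v \<in> Rep_rp2 (hpoint x y w). \<forall>u \<in> Rep_rp2 R. u \<bullet> (A *v v) = 0}"
    using assms
    by (auto simp: pline_def Rep_hpoint span_singleton matrix_vector_mult_scaleR inner_commute)
next
  fix R assume "R \<in> {R. \<forall>v \<in> Rep_rp2 (hpoint x y w). \<forall>u \<in> Rep_rp2 R. u \<bullet> (A *v v) = 0}"
  moreover have "vector [x, y, w] \<in> Rep_rp2 (hpoint x y w)"
    using assms by (simp add: Rep_hpoint span_base)
  ultimately show "R \<in> pline (A *v vector [x, y, w])"
    by (simp add: pline_def inner_commute)
qed

lemma pline_scale:
  assumes "c \<noteq> 0"
  shows "pline (c *\<^sub>R a) = pline a"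
  using assms by (auto simp: pline_def)

text \<open>The cross product is orthogonal to both coordinate vectors, and since it is nonzero the
  lines are distinct. The factor \<open>c\<close> leaves the choice of representative free.\<close>

lemma pline_inter_pline:
  assumes n: "cross3 a b = c *\<^sub>R vector [x, y, w]" and "c \<noteq> 0"
    and nz: "(vector [x, y, w] :: real^3) \<noteq> 0"
  shows "pline a \<inter> pline b = {hpoint x y w}"
proof (intro set_eqI iffI)
  let ?n = "vector [x, y, w] :: real^3"
  fix Q assume Q: "Q \<in> pline a \<inter> pline b"
  obtain x' y' w' where v: "(vector [x', y', w'] :: real^3) \<noteq> 0" "Q = hpoint x' y' w'"
    by (rule rp2_cases)
  let ?v = "vector [x', y', w'] :: real^3"
  have ab: "a \<bullet> ?v = 0" "b \<bullet> ?v = 0"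
    using Q v by (simp_all add: hpoint_in_pline_iff)
  \<comment> \<open>The triple product expands into multiples of \<open>a\<close> and
    \<open>b\<close> with coefficients \<open>b \<bullet> ?v\<close> and
    \<open>a \<bullet> ?v\<close>, both zero.\<close>
  have "cross3 ?v (cross3 a b) = 0"
    using ab by (simp add: Lagrange inner_commute)
  hence "cross3 ?v ?n = 0"
    using n \<open>c \<noteq> 0\<close> by (simp add: cross_mult_right)
  \<comment> \<open>A second triple product expresses the parallelism of \<open>?v\<close> and
    \<open>?n\<close> as an equation that can be solved for \<open>?v\<close>.\<close>
  hence "cross3 ?n (cross3 ?v ?n) = 0"
    by simp
  hence "(?n \<bullet> ?n) *\<^sub>R ?v = (?n \<bullet> ?v) *\<^sub>R ?n"
    by (simp add: Lagrange)
  hence "inverse (?n \<bullet> ?n) *\<^sub>R (?n \<bullet> ?n) *\<^sub>R ?v = inverse (?n \<bullet> ?n) *\<^sub>R (?n \<bullet> ?v) *\<^sub>R ?n"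
    by simp
  hence k: "?v = ((?n \<bullet> ?v) / (?n \<bullet> ?n)) *\<^sub>R ?n"
    using nz by (simp add: divide_inverse_commute)
  define k where "k = (?n \<bullet> ?v) / (?n \<bullet> ?n)"
  have "k \<noteq> 0"
    using k v(1) unfolding k_def by (metis scaleR_zero_left)
  moreover have "x' = k * x" "y' = k * y" "w' = k * w"
    using k[folded k_def] by (simp_all add: vec_eq_iff forall_3)
  ultimately show "Q \<in> {hpoint x y w}"
    using v(2) by (simp add: hpoint_scale)
next
  fix Q assume "Q \<in> {hpoint x y w}"
  moreover have "a \<bullet> cross3 a b = 0" "b \<bullet> cross3 a b = 0"
    by (simp_all add: dot_cross_self)
  ultimately show "Q \<in> pline a \<inter> pline b"
    using n \<open>c \<noteq> 0\<close> nz by (auto simp: hpoint_in_pline_iff)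
qed

section \<open>Polar equations with signed parameters\<close>

text \<open>A negative \<open>k\<close> is absorbed by a half-turn \<open>\<beta>\<close> of the
  angle, a negative \<open>m\<close> by a half-turn \<open>\<gamma>\<close> of the direction; the
  axis \<open>\<gamma> - \<beta>\<close> keeps the two corrections independent.\<close>

lemma polar_point_normalize:
  obtains \<alpha> \<beta> where "\<And>t. polar_point F \<alpha> \<bar>k\<bar> \<bar>m\<bar> (t + \<beta>) = polar_point F 0 k m t"
proof
  define \<beta> where "\<beta> = (if k < 0 then pi else 0)"
  define \<gamma> where "\<gamma> = (if m < 0 then pi else 0)"
  fix t
  have "\<bar>k\<bar> * cos (t + \<beta>) = k * cos t" "\<bar>m\<bar> * cos (t + \<gamma>) = m * cos t"
    "\<bar>m\<bar> * sin (t + \<gamma>) = m * sin t"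
    by (auto simp: \<beta>_def \<gamma>_def)
  moreover have "\<gamma> - \<beta> + (t + \<beta>) = t + \<gamma>"
    by simp
  ultimately show "polar_point F (\<gamma> - \<beta>) \<bar>k\<bar> \<bar>m\<bar> (t + \<beta>) = polar_point F 0 k m t"
    by (simp only: polar_point_def add_0)
qed

text \<open>The shift \<open>\<beta>\<close> is the same for all \<open>t\<close>, so differences of
  parameters survive the normalization and can be read as focal angles.\<close>

lemma polar_equation_signed:
  assumes "m \<noteq> 0"
  obtains \<alpha> \<beta> where "polar_equation (range (polar_point F 0 k m)) F \<alpha> \<bar>k\<bar> \<bar>m\<bar>"
    and "\<And>t. polar_point F 0 k m t = polar_point F \<alpha> \<bar>k\<bar> \<bar>m\<bar> (t + \<beta>)"
proof -
  obtain \<alpha> \<beta> where ab: "\<And>t. polar_point F \<alpha> \<bar>k\<bar> \<bar>m\<bar> (t + \<beta>) = polar_point F 0 k m t"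
    using polar_point_normalize by blast
  have "range (polar_point F 0 k m) = range (polar_point F \<alpha> \<bar>k\<bar> \<bar>m\<bar>)"
  proof (intro set_eqI iffI)
    fix Q assume "Q \<in> range (polar_point F \<alpha> \<bar>k\<bar> \<bar>m\<bar>)"
    then obtain s where "Q = polar_point F \<alpha> \<bar>k\<bar> \<bar>m\<bar> s"
      by blast
    with ab[of "s - \<beta>"] show "Q \<in> range (polar_point F 0 k m)"
      by simp
  qed (auto simp flip: ab)
  hence "polar_equation (range (polar_point F 0 k m)) F \<alpha> \<bar>k\<bar> \<bar>m\<bar>"
    using assms by (simp add: polar_equation_def)
  from that[OF this ab[symmetric]] show ?thesis .
qed

text \<open>Where \<open>1 + k * cos t\<close> vanishes, the other coordinates reduce to
  \<open>m * cos t\<close> and \<open>m * sin t\<close>, which have no common zero: this is the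
  point at infinity in direction \<open>t\<close>.\<close>

lemma polar_vector_nonzero:
  assumes "m \<noteq> 0"
  shows "(vector [(1 + k * cos t) * f + m * cos t, (1 + k * cos t) * g + m * sin t,
    1 + k * cos t] :: real^3) \<noteq> 0"
proof
  assume z: "(vector [(1 + k * cos t) * f + m * cos t, (1 + k * cos t) * g + m * sin t,
    1 + k * cos t] :: real^3) = 0"
  hence "1 + k * cos t = 0"
    by (simp add: vector_3_eq_0_iff)
  with z assms have "cos t = 0" "sin t = 0"
    by (simp_all add: vector_3_eq_0_iff)
  thus False
    using sin_cos_squared_add[of t] by simp
qed

text \<open>
  Matrix of the form \<open>x'\<^sup>2 + y'\<^sup>2 - (m w - k x')\<^sup>2\<close>, where \<open>x' = x - f w\<close> and \<open>y' = y - g w\<close>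
  for \<open>F = (f, g)\<close>: squaring \<open>r = m - k x'\<close> removes the sign of \<open>r\<close>.
\<close>

definition polar_matrix :: "real^2 \<Rightarrow> real \<Rightarrow> real \<Rightarrow> real^3^3" where
  "polar_matrix F k m = vector
    [vector [1 - k\<^sup>2, 0, k * (m + k * F $ 1) - F $ 1],
     vector [0, 1, - F $ 2],
     vector [k * (m + k * F $ 1) - F $ 1, - F $ 2,
       (F $ 1)\<^sup>2 + (F $ 2)\<^sup>2 - (m + k * F $ 1)\<^sup>2]]"

lemma transpose_polar_matrix: "transpose (polar_matrix F k m) = polar_matrix F k m"
  by (simp add: polar_matrix_def transpose_def vec_eq_iff forall_3)

lemma det_polar_matrix: "det (polar_matrix F k m) = - m\<^sup>2"
  by (simp add: polar_matrix_def det_3 algebra_simps power2_eq_square)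

lemma polar_matrix_form:
  "vector [x, y, w] \<bullet> (polar_matrix F k m *v vector [x, y, w])
    = (x - F $ 1 * w)\<^sup>2 + (y - F $ 2 * w)\<^sup>2 - (m * w - k * (x - F $ 1 * w))\<^sup>2"
  by (simp add: polar_matrix_def matrix_vector_mult_def inner_vec_def sum_3 algebra_simps power2_eq_square)

lemma range_polar_point_eq_quadric:
  assumes "m \<noteq> 0"
  shows "range (polar_point F 0 k m) = quadric (polar_matrix F k m)"
proof (intro set_eqI iffI)
  fix Q assume "Q \<in> range (polar_point F 0 k m)"
  then obtain t where Q: "Q = polar_point F 0 k m t"
    by blast
  have "(m * cos t)\<^sup>2 + (m * sin t)\<^sup>2 = m\<^sup>2"
    using sin_cos_squared_add[of t] by algebra
  thus "Q \<in> quadric (polar_matrix F k m)"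
    unfolding Q polar_point_def add_0
      hpoint_in_quadric_iff[OF polar_vector_nonzero[OF assms]] polar_matrix_form
    by (simp add: algebra_simps)
next
  fix Q assume Q: "Q \<in> quadric (polar_matrix F k m)"
  obtain x y w where v: "(vector [x, y, w] :: real^3) \<noteq> 0" "Q = hpoint x y w"
    by (rule rp2_cases)
  \<comment> \<open>Homogeneous version of the signed radius \<open>r = m - k x'\<close>. It
    vanishes at no point of the conic, not even at infinity, so \<open>(x', y') / u\<close> is a
    unit vector and yields the angle \<open>t\<close>.\<close>
  define u where "u = m * w - k * (x - F $ 1 * w)"
  have form: "(x - F $ 1 * w)\<^sup>2 + (y - F $ 2 * w)\<^sup>2 = u\<^sup>2"
    using Q v by (simp add: hpoint_in_quadric_iff polar_matrix_form u_def)
  have "u \<noteq> 0"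
  proof
    assume "u = 0"
    with form have "x = F $ 1 * w" "y = F $ 2 * w"
      by (simp_all add: sum_power2_eq_zero_iff)
    with \<open>u = 0\<close> assms v(1) show False
      by (simp add: u_def vector_3_eq_0_iff)
  qed
  with form have "((x - F $ 1 * w) / u)\<^sup>2 + ((y - F $ 2 * w) / u)\<^sup>2 = 1"
    by (simp add: power_divide flip: add_divide_distrib)
  then obtain t where "(x - F $ 1 * w) / u = cos t" "(y - F $ 2 * w) / u = sin t"
    using sincos_total_2pi by metis
  with \<open>u \<noteq> 0\<close> have t: "x - F $ 1 * w = u * cos t" "y - F $ 2 * w = u * sin t"
    by (simp_all add: field_simps)
  \<comment> \<open>Solve \<open>u = m * w - k * u * cos t\<close> for \<open>w\<close>;
    \<open>u / m\<close> is the common factor between the given coordinates and those of the polar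
    point.\<close>
  have w: "w = u / m * (1 + k * cos t)"
    using u_def t(1) assms by (simp add: field_simps)
  have "x = u / m * ((1 + k * cos t) * F $ 1 + m * cos t)"
    "y = u / m * ((1 + k * cos t) * F $ 2 + m * sin t)"
    using t w assms by (simp_all add: field_simps)
  with w have "Q = hpoint (u / m * ((1 + k * cos t) * F $ 1 + m * cos t))
      (u / m * ((1 + k * cos t) * F $ 2 + m * sin t)) (u / m * (1 + k * cos t))"
    using v(2) by blast
  also have "\<dots> = polar_point F 0 k m t"
    using \<open>u \<noteq> 0\<close> assms by (subst hpoint_scale) (simp_all add: polar_point_def)
  finally show "Q \<in> range (polar_point F 0 k m)"
    by blast
qed

lemma conic_with_focus_range_polar_point:
  assumes "m \<noteq> 0"
  shows "conic_with_focus (range (polar_point F 0 k m)) F"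
proof -
  have "nondegenerate_conic (range (polar_point F 0 k m))"
    unfolding nondegenerate_conic_def
    using range_polar_point_eq_quadric[OF assms] transpose_polar_matrix det_polar_matrix assms
    by (metis UNIV_not_empty image_is_empty neg_equal_0_iff_equal power_not_zero)
  moreover obtain \<alpha> \<beta> where "polar_equation (range (polar_point F 0 k m)) F \<alpha> \<bar>k\<bar> \<bar>m\<bar>"
    using polar_equation_signed[OF assms] by metis
  ultimately show ?thesis
    unfolding conic_with_focus_def by blast
qed

lemma focal_angle_polar_point:
  assumes "m \<noteq> 0"
  shows "focal_angle (range (polar_point F 0 k m)) F
    (polar_point F 0 k m t) (polar_point F 0 k m (t + \<theta>)) \<theta>"
proof -
  obtain \<alpha> \<beta> where ab: "polar_equation (range (polar_point F 0 k m)) F \<alpha> \<bar>k\<bar> \<bar>m\<bar>"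
    "\<And>t. polar_point F 0 k m t = polar_point F \<alpha> \<bar>k\<bar> \<bar>m\<bar> (t + \<beta>)"
    using polar_equation_signed[OF assms] by metis
  have "[t + \<theta> + \<beta> - (t + \<beta>) = \<theta>] (rmod (2 * pi))"
    by simp
  with ab show ?thesis
    unfolding focal_angle_def by metis
qed

lemma discrete_conic_polar_point:
  assumes "m \<noteq> 0" and "\<And>n. t (Suc n) = t n + \<theta>"
  shows "discrete_conic (range (polar_point F 0 k m)) F \<theta> (\<lambda>n. polar_point F 0 k m (t n))"
  using assms conic_with_focus_range_polar_point focal_angle_polar_point
  by (simp add: discrete_conic_def)

section \<open>The limiting conic\<close>

lemma perp_coords_circle_point:
  "perp_coords (vector [p, 0]) (circle_point t) = vector [cos t - p, sin t, p * cos t - 1]"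
proof -
  have "(cos t - p) * cos t + sin t * sin t = 1 - p * cos t"
    using sin_cos_squared_add[of t] by algebra
  thus ?thesis
    by (simp add: perp_coords_def circle_point_def vec_eq_iff forall_3 inner_vec_def sum_2)
qed

lemma perp_coords_has_vector_derivative:
  "((\<lambda>t. perp_coords (vector [p, 0]) (circle_point t)) has_vector_derivative
    vector [- sin t, cos t, - p * sin t]) (at t)"
proof -
  \<comment> \<open>Written as a combination of constant basis vectors, the curve is open to the
    scalar differentiation rules.\<close>
  have e: "(vector [x, y, z] :: real^3) = x *\<^sub>R axis 1 1 + y *\<^sub>R axis 2 1 + z *\<^sub>R axis 3 1"
    for x y z
    by (simp add: vec_eq_iff forall_3 axis_def)
  show ?thesis
    unfolding perp_coords_circle_point e
    by (auto intro!: derivative_eq_intros simp: has_real_derivative_iff_has_vector_derivative[symmetric])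
qed

text \<open>These points satisfy \<open>x^2 + y^2 / (1 - p^2) = 1\<close> in affine coordinates: an
  ellipse for \<open>\<bar>p\<bar> < 1\<close>, a hyperbola for
  \<open>\<bar>p\<bar> > 1\<close>.\<close>

lemma polar_point_left_focus:
  "polar_point (vector [- p, 0]) 0 (- p) (1 - p\<^sup>2) t
    = hpoint (cos t - p) ((1 - p\<^sup>2) * sin t) (1 - p * cos t)"
  by (simp add: polar_point_def algebra_simps power2_eq_square)

lemma tangency_vector_nonzero:
  assumes "p\<^sup>2 \<noteq> 1"
  shows "(vector [cos t - p, (1 - p\<^sup>2) * sin t, 1 - p * cos t] :: real^3) \<noteq> 0"
  using polar_vector_nonzero[of "1 - p\<^sup>2" "- p" t "- p" 0] assms
  by (simp add: algebra_simps power2_eq_square)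

lemma limiting_conic_eq:
  assumes "p\<^sup>2 \<noteq> 1"
  shows "limiting_conic (vector [p, 0]) = range (polar_point (vector [- p, 0]) 0 (- p) (1 - p\<^sup>2))"
proof -
  let ?a = "\<lambda>t. perp_coords (vector [p, 0]) (circle_point t)"
  have I: "pline (?a t) \<inter> pline (vector [- sin t, cos t, - p * sin t])
    = {polar_point (vector [- p, 0]) 0 (- p) (1 - p\<^sup>2) t}" for t
  proof -
    have "- (sin t * (p * sin t)) - (p * cos t - 1) * cos t = cos t - p"
      "(cos t - p) * cos t + sin t * sin t = 1 - p * cos t"
      using sin_cos_squared_add[of t] by algebra+
    moreover have "(cos t - p) * (p * sin t) - (p * cos t - 1) * sin t = (1 - p\<^sup>2) * sin t"
      by algebra
    ultimately have "cross3 (?a t) (vector [- sin t, cos t, - p * sin t])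
      = 1 *\<^sub>R vector [cos t - p, (1 - p\<^sup>2) * sin t, 1 - p * cos t]"
      by (simp add: perp_coords_circle_point cross3_def vec_eq_iff forall_3)
    thus ?thesis
      unfolding polar_point_left_focus
      using pline_inter_pline tangency_vector_nonzero[OF assms] by (metis zero_neq_one)
  qed
  \<comment> \<open>Uniqueness of derivatives replaces the existential \<open>a'\<close> of
    \<open>envelope\<close> by the computed one, so each \<open>t\<close> contributes exactly one
    point.\<close>
  have "Q \<in> limiting_conic (vector [p, 0])
    \<longleftrightarrow> (\<exists>t. Q \<in> pline (?a t) \<inter> pline (vector [- sin t, cos t, - p * sin t]))" for Q
    unfolding limiting_conic_def envelope_def
    using perp_coords_has_vector_derivative vector_derivative_unique_at by blast
  thus ?thesis
    unfolding I by auto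
qed

text \<open>The limiting conic is symmetric in the \<open>y\<close>-axis, which exchanges the foci.\<close>

lemma range_polar_point_foci:
  assumes "p\<^sup>2 \<noteq> 1"
  shows "range (polar_point (vector [- p, 0]) 0 (- p) (1 - p\<^sup>2))
    = range (polar_point (vector [p, 0]) 0 p (1 - p\<^sup>2))"
proof -
  have "polar_matrix (vector [- p, 0]) (- p) (1 - p\<^sup>2) = polar_matrix (vector [p, 0]) p (1 - p\<^sup>2)"
    by (simp add: polar_matrix_def algebra_simps power2_eq_square)
  thus ?thesis
    using assms by (simp add: range_polar_point_eq_quadric)
qed

text \<open>Applying the matrix of the conic to the tangency point returns the coordinates of the
  perpendicular line, up to the nonzero factor \<open>1 - p^2\<close>.\<close>

lemma tangent_line_perp_line:
  assumes "p\<^sup>2 \<noteq> 1"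
  shows "tangent_line (limiting_conic (vector [p, 0]))
    (polar_point (vector [- p, 0]) 0 (- p) (1 - p\<^sup>2) t) (perp_line (vector [p, 0]) (circle_point t))"
proof -
  let ?A = "polar_matrix (vector [- p, 0]) (- p) (1 - p\<^sup>2)"
  have m: "1 - p\<^sup>2 \<noteq> 0"
    using assms by simp
  have "?A *v vector [cos t - p, (1 - p\<^sup>2) * sin t, 1 - p * cos t]
    = (1 - p\<^sup>2) *\<^sub>R perp_coords (vector [p, 0]) (circle_point t)"
    by (simp add: perp_coords_circle_point polar_matrix_def matrix_vector_mult_def sum_3
        vec_eq_iff forall_3 algebra_simps power2_eq_square)
  hence "perp_line (vector [p, 0]) (circle_point t)
    = pline (?A *v vector [cos t - p, (1 - p\<^sup>2) * sin t, 1 - p * cos t])"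
    using m by (simp add: perp_line_def pline_scale)
  hence "perp_line (vector [p, 0]) (circle_point t)
    = {R. \<forall>v \<in> Rep_rp2 (polar_point (vector [- p, 0]) 0 (- p) (1 - p\<^sup>2) t).
        \<forall>w \<in> Rep_rp2 R. w \<bullet> (?A *v v) = 0}"
    by (simp only: polar_point_left_focus polar_of_hpoint[OF tangency_vector_nonzero[OF assms]])
  moreover have "det ?A \<noteq> 0"
    using m by (simp add: det_polar_matrix)
  ultimately show ?thesis
    unfolding tangent_line_def limiting_conic_eq[OF assms]
    by (intro conjI rangeI exI[of _ ?A] transpose_polar_matrix range_polar_point_eq_quadric m)
qed

text \<open>Substituting the point of parameter \<open>s\<close> into the line of parameter
  \<open>t\<close> gives \<open>(1 - p^2) * (cos (t - s) - 1)\<close>, which vanishes only if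
  \<open>s\<close> and \<open>t\<close> agree modulo \<open>2 * pi\<close>.\<close>

lemma limiting_conic_inter_perp_line:
  assumes "p\<^sup>2 \<noteq> 1"
  shows "limiting_conic (vector [p, 0]) \<inter> perp_line (vector [p, 0]) (circle_point t)
    = {polar_point (vector [- p, 0]) 0 (- p) (1 - p\<^sup>2) t}" (is "_ = {?M t}")
proof -
  have on_line: "?M s \<in> perp_line (vector [p, 0]) (circle_point t) \<longleftrightarrow> cos (t - s) = 1" for s
  proof -
    have "perp_coords (vector [p, 0]) (circle_point t)
        \<bullet> vector [cos s - p, (1 - p\<^sup>2) * sin s, 1 - p * cos s] = (1 - p\<^sup>2) * (cos (t - s) - 1)"
      by (simp add: perp_coords_circle_point inner_vec_def sum_3 cos_diff) algebra
    with assms show ?thesis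
      by (simp add: perp_line_def polar_point_left_focus hpoint_in_pline_iff
          tangency_vector_nonzero)
  qed
  have unique: "?M s = ?M t" if "cos (t - s) = 1" for s
  proof -
    have "sin (t - s) = 0"
      using that sin_cos_squared_add[of "t - s"] by simp
    with that have "cos t = cos s" "sin t = sin s"
      using cos_add[of "t - s" s] sin_add[of "t - s" s] by simp_all
    thus ?thesis
      by (simp add: polar_point_left_focus)
  qed
  show ?thesis
  \<comment> \<open>Both inclusions run through the parametrization of the conic by
    \<open>?M\<close>.\<close>
  proof (intro set_eqI iffI)
    fix Q assume "Q \<in> limiting_conic (vector [p, 0]) \<inter> perp_line (vector [p, 0]) (circle_point t)"
    then obtain s where "Q = ?M s" "cos (t - s) = 1"
      using on_line unfolding limiting_conic_eq[OF assms] by blast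
    thus "Q \<in> {?M t}"
      using unique by blast
  next
    fix Q assume "Q \<in> {?M t}"
    moreover have "?M t \<in> perp_line (vector [p, 0]) (circle_point t)"
      by (simp add: on_line)
    ultimately show "Q \<in> limiting_conic (vector [p, 0]) \<inter> perp_line (vector [p, 0]) (circle_point t)"
      unfolding limiting_conic_eq[OF assms] by blast
  qed
qed

lemma perp_line_inter_perp_line:
  assumes "p\<^sup>2 \<noteq> 1" and "0 < \<theta>" and "\<theta> < pi"
  shows "perp_line (vector [p, 0]) (circle_point t) \<inter> perp_line (vector [p, 0]) (circle_point (t + \<theta>))
    = {polar_point (vector [- p, 0]) 0 (- p / cos (\<theta> / 2)) ((1 - p\<^sup>2) / cos (\<theta> / 2)) (t + \<theta> / 2)}"
proof -
  \<comment> \<open>Parameters symmetric about the midpoint \<open>m\<close> make all three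
    coordinates of the cross product share the factor \<open>2 * sin h\<close>. From
    \<open>0 < h < pi / 2\<close>, both \<open>sin h\<close> and \<open>cos h\<close> are
    positive.\<close>
  define h where "h = \<theta> / 2"
  define m where "m = t + h"
  have t: "t = m - h" "t + \<theta> = m + h"
    by (simp_all add: m_def h_def)
  have ch: "cos h > 0"
    using assms by (intro cos_gt_zero_pi) (auto simp: h_def)
  have sh: "sin h > 0"
    using assms by (intro sin_gt_zero) (auto simp: h_def)
  let ?k = "- p / cos h" and ?m = "(1 - p\<^sup>2) / cos h"
  let ?v = "vector [(1 + ?k * cos m) * - p + ?m * cos m, (1 + ?k * cos m) * 0 + ?m * sin m,
    1 + ?k * cos m] :: real^3"
  \<comment> \<open>Division by \<open>cos h\<close> brings the last coordinate
    \<open>cos h - p * cos m\<close> to the polar form \<open>1 + ?k * cos m\<close>.\<close>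
  have v: "?v = (1 / cos h) *\<^sub>R vector [cos m - p * cos h, (1 - p\<^sup>2) * sin m, cos h - p * cos m]"
    using ch by (simp add: vec_eq_iff forall_3 field_simps power2_eq_square)
  have "(sin m * cos h - cos m * sin h) * (p * (cos m * cos h - sin m * sin h) - 1)
      - (p * (cos m * cos h + sin m * sin h) - 1) * (sin m * cos h + cos m * sin h)
      = 2 * sin h * (cos m - p * cos h)"
    "(cos m * cos h + sin m * sin h - p) * (sin m * cos h + cos m * sin h)
      - (sin m * cos h - cos m * sin h) * (cos m * cos h - sin m * sin h - p)
      = 2 * sin h * (cos h - p * cos m)"
    using sin_cos_squared_add[of m] by algebra+
  moreover have "(p * (cos m * cos h + sin m * sin h) - 1) * (cos m * cos h - sin m * sin h - p)
      - (cos m * cos h + sin m * sin h - p) * (p * (cos m * cos h - sin m * sin h) - 1)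
      = 2 * sin h * ((1 - p\<^sup>2) * sin m)"
    by algebra
  ultimately have "cross3 (perp_coords (vector [p, 0]) (circle_point (m - h)))
      (perp_coords (vector [p, 0]) (circle_point (m + h)))
    = (2 * sin h) *\<^sub>R vector [cos m - p * cos h, (1 - p\<^sup>2) * sin m, cos h - p * cos m]"
    by (simp add: perp_coords_circle_point cross3_def vec_eq_iff forall_3
        cos_diff cos_add sin_diff sin_add)
  also have "\<dots> = (2 * sin h * cos h) *\<^sub>R ?v"
    unfolding v using ch by simp
  finally have "pline (perp_coords (vector [p, 0]) (circle_point (m - h)))
      \<inter> pline (perp_coords (vector [p, 0]) (circle_point (m + h)))
    = {hpoint ((1 + ?k * cos m) * - p + ?m * cos m) ((1 + ?k * cos m) * 0 + ?m * sin m)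
        (1 + ?k * cos m)}"
    using ch sh assms by (intro pline_inter_pline polar_vector_nonzero) auto
  thus ?thesis
    unfolding perp_line_def h_def[symmetric] m_def[symmetric] t(2)
    by (simp add: polar_point_def m_def)
qed

theorem theorem11:
  fixes p \<theta> :: real and P P' :: "real^2"
    and X :: "real \<Rightarrow> int \<Rightarrow> real^2" and L :: "real \<Rightarrow> int \<Rightarrow> rp2 set"
    and C\<^sub>L :: "rp2 set"
  assumes "p \<noteq> 1" and "p \<noteq> -1"
    and "P = vector [p, 0]" and "P' = vector [- p, 0]"
    and "0 < \<theta>" and "\<theta> < pi"
    and "\<And>\<phi> j. X \<phi> j = vector [cos (of_int j * \<theta> + \<phi>), sin (of_int j * \<theta> + \<phi>)]"
    and "\<And>\<phi> j. L \<phi> j = perp_line P (X \<phi> j)"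
    and "C\<^sub>L = limiting_conic P"
  shows "conic_with_focus C\<^sub>L P \<and> conic_with_focus C\<^sub>L P' \<and>
    (\<exists>C. conic_with_focus C P' \<and>
      (\<forall>\<phi>. \<exists>M V :: int \<Rightarrow> rp2.
         (\<forall>j. C\<^sub>L \<inter> L \<phi> j = {M j} \<and> tangent_line C\<^sub>L (M j) (L \<phi> j)) \<and>
         (\<forall>j. L \<phi> j \<inter> L \<phi> (j + 1) = {V j}) \<and>
         (\<forall>j. V j \<in> C) \<and>
         (\<forall>k. discrete_conic C P' \<theta> (\<lambda>n. V (k + int n))) \<and>
         is_G C\<^sub>L P' \<theta> (\<lambda>n. M (1 + int n)) (\<lambda>n. V (1 + int n))))"
proof -
  have p: "p\<^sup>2 \<noteq> 1" "1 - p\<^sup>2 \<noteq> 0"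
    using assms(1,2) by (auto simp: power2_eq_1_iff)
  have m: "(1 - p\<^sup>2) / cos (\<theta> / 2) \<noteq> 0"
    using p cos_gt_zero_pi[of "\<theta> / 2"] assms(5,6) by simp
  have L: "L \<phi> j = perp_line (vector [p, 0]) (circle_point (of_int j * \<theta> + \<phi>))" for \<phi> j
    using assms by (simp add: circle_point_def)
  have CL: "C\<^sub>L = range (polar_point P' 0 (- p) (1 - p\<^sup>2))"
    using assms limiting_conic_eq[OF p(1)] by simp
  \<comment> \<open>Its parameters involve only \<open>p\<close> and \<open>\<theta>\<close>;
    \<open>\<phi>\<close> enters the vertices through the polar angle alone. Hence one conic serves
    every \<open>\<phi>\<close>.\<close>
  let ?C = "range (polar_point P' 0 (- p / cos (\<theta> / 2)) ((1 - p\<^sup>2) / cos (\<theta> / 2)))"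
  have "\<exists>M V :: int \<Rightarrow> rp2.
         (\<forall>j. C\<^sub>L \<inter> L \<phi> j = {M j} \<and> tangent_line C\<^sub>L (M j) (L \<phi> j)) \<and>
         (\<forall>j. L \<phi> j \<inter> L \<phi> (j + 1) = {V j}) \<and>
         (\<forall>j. V j \<in> ?C) \<and>
         (\<forall>k. discrete_conic ?C P' \<theta> (\<lambda>n. V (k + int n))) \<and>
         is_G C\<^sub>L P' \<theta> (\<lambda>n. M (1 + int n)) (\<lambda>n. V (1 + int n))" for \<phi>
  proof -
    define M where "M j = polar_point P' 0 (- p) (1 - p\<^sup>2) (of_int j * \<theta> + \<phi>)" for j :: int
    \<comment> \<open>The angle is halfway between the circle parameters of
      \<open>L \<phi> j\<close> and \<open>L \<phi> (j + 1)\<close>.\<close>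
    define V where "V j = polar_point P' 0 (- p / cos (\<theta> / 2)) ((1 - p\<^sup>2) / cos (\<theta> / 2))
      (of_int j * \<theta> + \<phi> + \<theta> / 2)" for j :: int
    have M: "C\<^sub>L \<inter> L \<phi> j = {M j}" "tangent_line C\<^sub>L (M j) (L \<phi> j)" for j
      using limiting_conic_inter_perp_line[OF p(1)] tangent_line_perp_line[OF p(1)]
      by (simp_all add: L M_def assms(3,4,9))
    have V: "L \<phi> j \<inter> L \<phi> (j + 1) = {V j}" for j
    proof -
      have "of_int (j + 1) * \<theta> + \<phi> = of_int j * \<theta> + \<phi> + \<theta>"
        by (simp add: algebra_simps)
      thus ?thesis
        unfolding L V_def assms(4)
        using perp_line_inter_perp_line[OF p(1) assms(5,6)] by metis
    qed
    have "discrete_conic ?C P' \<theta> (\<lambda>n. V (k + int n))" for k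
      unfolding V_def by (intro discrete_conic_polar_point m) (simp add: algebra_simps)
    moreover have "discrete_conic C\<^sub>L P' \<theta> (\<lambda>n. M (1 + int n))"
      unfolding M_def CL by (intro discrete_conic_polar_point p) (simp add: algebra_simps)
    hence "is_G C\<^sub>L P' \<theta> (\<lambda>n. M (1 + int n)) (\<lambda>n. V (1 + int n))"
      \<comment> \<open>The tangents at consecutive points of \<open>M\<close> are the lines
        \<open>L \<phi> (1 + int n)\<close> and \<open>L \<phi> (1 + int n + 1)\<close>, which meet
        in the vertex with the index of the first.\<close>
      unfolding is_G_def using M(2) V by (metis add.assoc add.commute of_nat_Suc)
    moreover have "V j \<in> ?C" for j
      by (simp add: V_def)
    ultimately show ?thesis
      using M V by blast
  qed
  moreover have "conic_with_focus C\<^sub>L P"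
    unfolding CL assms(3,4) range_polar_point_foci[OF p(1)]
    by (rule conic_with_focus_range_polar_point[OF p(2)])
  moreover have "conic_with_focus C\<^sub>L P'"
    unfolding CL by (rule conic_with_focus_range_polar_point[OF p(2)])
  moreover have "conic_with_focus ?C P'"
    by (rule conic_with_focus_range_polar_point[OF m])
  ultimately show ?thesis
    by blast
qed

end
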